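(* Let $\mathfrak{C}$ be a covariance model. Let $T$ be a nonsphericity-corrected F-type test statistic based on $\check\beta$ and $\check\Omega$, where $(\check\beta,\check\Omega,N)$ satisfies the estimator conditions with $N=\emptyset$. Furthermore, assume that $\check\Omega(y)$ is nonnegative definite for every $y\in\mathbb{R}^n$. If there exists $\mathcal{S}\in\mathbb{J}(\mathfrak{M}_0^{lin},\mathfrak{C})$ satisfying $\mathcal{S}\subseteq\mathrm{span}(X)$, then $$\sup_{\Sigma\in\mathfrak{C}}P_{\mu_0,\sigma^2\Sigma}(T\ge C)=1$$ holds for every critical value $C$, $-\infty<C<\infty$, for every $\mu_0\in\mathfrak{M}_0$, and for every $\sigma^2\in(0,\infty)$.
   Context: Model: $n,k,q$ are positive integers with $1\le k<n$; $X\in\mathbb{R}^{n\times k}$ is a fixed matrix of rank $k$; $R\in\mathbb{R}^{q\times k}$ has rank $q\ge 1$; $r\in\mathbb{R}^q$. (One tests $R\beta=r$ against $R\beta\ne r$ in $\mathbf{Y}=X\beta+\mathbf{U}$ with $\mathbf{U}\sim N(0,\sigma^2\Sigma)$, $0<\sigma^2<\infty$, $\Sigma\in\mathfrak{C}$.) Here $\mathrm{span}(\cdot)$ is column space, $'$ is transpose, $\mathfrak{M}=\mathrm{span}(X)$, $\mathfrak{M}_0=\{X\beta:\beta\in\mathbb{R}^k,R\beta=r\}$, and $\mathfrak{M}_0^{lin}=\{X\beta:\beta\in\mathbb{R}^k,R\beta=0\}$. $P_{\mu,A}$ is the Gaussian measure on $\mathbb{R}^n$ with mean $\mu$ and covariance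 matrix $A$; $P(T\ge C)$ means $P(\{y\in\mathbb{R}^n:T(y)\ge C\})$. $\lambda_{\mathbb{R}^n}$ is Lebesgue measure. Covariance model: a nonempty set $\mathfrak{C}$ of symmetric positive definite real $n\times n$ matrices such that $\Sigma\in\mathfrak{C}$ implies $\delta\Sigma\notin\mathfrak{C}$ for every $\delta\ne1$. For a linear subspace $\mathcal{L}$ of $\mathbb{R}^n$ with $\dim\mathcal{L}<n$, let $\Pi_{\mathcal{L}^\perp}$ be the orthogonal projection onto $\mathcal{L}^\perp$, $\mathcal{L}(\Sigma)=\Pi_{\mathcal{L}^\perp}\Sigma\Pi_{\mathcal{L}^\perp}/\|\Pi_{\mathcal{L}^\perp}\Sigma\Pi_{\mathcal{L}^\perp}\|$ (with $\|\cdot\|$ any norm on $\mathbb{R}^{n\times n}$), $\mathcal{L}(\mathfrak{C})=\{\mathcal{L}(\Sigma):\Sigma\in\mathfrak{C}\}$, and $$\mathbb{J}(\mathcal{L},\mathfrak{C})=\{\mathrm{span}(\bar\Sigma):\bar\Sigma\in\mathrm{cl}(\mathcal{L}(\mathfrak{C})),\ \mathrm{rank}(\bar\Sigma)<n-\dim(\mathcal{L})\},$$ with closure in $\mathbb{R}^{n\times n}$ (the definition does not depend on the norm). Estimator conditions on $(\check\beta,\check\Omega,N)$: (i) $\check\beta:\mathbb{R}^n\setminus N\to\mathbb{R}^k$ and $\check\Omega:\mathbb{R}^n\setminus N\to\mathbb{R}^{q\times q}$ are well-defined and continuous on $\mathbb{R}^n\setminus N$, where $N$ is a closed $\lambda_{\mathbb{R}^n}$-null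 set, and $\check\Omega(y)$ is symmetric for every $y\in\mathbb{R}^n\setminus N$; (ii) $y\in\mathbb{R}^n\setminus N$ implies $\delta y+X\eta\in\mathbb{R}^n\setminus N$ for all $\delta\ne0$, $\eta\in\mathbb{R}^k$; (iii) $\check\beta(\delta y+X\eta)=\delta\check\beta(y)+\eta$ and $\check\Omega(\delta y+X\eta)=\delta^2\check\Omega(y)$ for all $y\in\mathbb{R}^n\setminus N$, $\delta\neq0$, $\eta\in\mathbb{R}^k$; (iv) $\check\Omega$ is $\lambda_{\mathbb{R}^n}$-almost everywhere nonsingular on $\mathbb{R}^n\setminus N$. Nonsphericity-corrected F-type test statistic: with $N^*=N\cup\{y\in\mathbb{R}^n\setminus N:\det\check\Omega(y)=0\}$, $T(y)=(R\check\beta(y)-r)'\check\Omega^{-1}(y)(R\check\beta(y)-r)$ for $y\in\mathbb{R}^n\setminus N^*$ and $T(y)=0$ for $y\in N^*$. *)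

theory Defs
  imports "HOL-Probability.Probability"
begin

(* A real (m x n)-matrix is an element of real^'n^'m, so the column space span(A) is
   span (columns A). *)

definition symmetric_mat :: "real^'n^'n \<Rightarrow> bool" where
  "symmetric_mat A \<longleftrightarrow> transpose A = A"

definition pos_def_mat :: "real^'n^'n \<Rightarrow> bool" where
  "pos_def_mat A \<longleftrightarrow> (\<forall>x. x \<noteq> 0 \<longrightarrow> 0 < x \<bullet> (A *v x))"

definition nonneg_def_mat :: "real^'n^'n \<Rightarrow> bool" where
  "nonneg_def_mat A \<longleftrightarrow> (\<forall>x. 0 \<le> x \<bullet> (A *v x))"

(* Lebesgue density of N(mu, A), for symmetric positive definite A only; degenerate normal
   distributions are not covered. *)
definition gaussian_measure :: "real^'n \<Rightarrow> real^'n^'n \<Rightarrow> (real^'n) measure" where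
  "gaussian_measure \<mu> A = density lborel (\<lambda>y. ennreal
     (exp (- ((y - \<mu>) \<bullet> (matrix_inv A *v (y - \<mu>))) / 2) / sqrt ((2 * pi) ^ CARD('n) * det A)))"

definition covariance_model :: "(real^'n^'n) set \<Rightarrow> bool" where
  "covariance_model \<CC> \<longleftrightarrow> \<CC> \<noteq> {} \<and>
     (\<forall>\<Sigma>\<in>\<CC>. symmetric_mat \<Sigma> \<and> pos_def_mat \<Sigma>) \<and>
     (\<forall>\<Sigma>\<in>\<CC>. \<forall>\<delta>::real. \<delta> \<noteq> 1 \<longrightarrow> \<delta> *\<^sub>R \<Sigma> \<notin> \<CC>)"

definition M0 :: "real^'k^'n \<Rightarrow> real^'k^'q \<Rightarrow> real^'q \<Rightarrow> (real^'n) set" where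
  "M0 X R r = {X *v \<beta> | \<beta>. R *v \<beta> = r}"

definition M0_lin :: "real^'k^'n \<Rightarrow> real^'k^'q \<Rightarrow> (real^'n) set" where
  "M0_lin X R = {X *v \<beta> | \<beta>. R *v \<beta> = 0}"

(* Matrix of the orthogonal projection onto a linear subspace V. *)
definition orth_proj :: "(real^'n) set \<Rightarrow> real^'n^'n" where
  "orth_proj V = matrix (\<lambda>x. THE p. p \<in> V \<and> x - p \<in> V\<^sup>\<bottom>)"

lemma orth_proj_works:
  fixes V :: "(real^'n) set"
  assumes "subspace V"
  shows "orth_proj V *v x \<in> V \<and> x - orth_proj V *v x \<in> V\<^sup>\<bottom>"
proof -
  let ?P = "\<lambda>x p. p \<in> V \<and> x - p \<in> V\<^sup>\<bottom>"
  define f where "f = (\<lambda>x. THE p. ?P x p)"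
  have uniq: "p = p'" if "?P x p" "?P x p'" for x p p'
  proof -
    have "p - p' \<in> V" using that assms by (simp add: subspace_diff)
    moreover have "p - p' \<in> V\<^sup>\<bottom>"
      using subspace_diff[OF subspace_orthogonal_comp, of "x - p'" V "x - p"] that by simp
    ultimately have "orthogonal (p - p') (p - p')"
      unfolding orthogonal_comp_def by blast
    then show ?thesis by (simp add: orthogonal_def)
  qed
  have ex: "\<exists>p. ?P x p" for x
  proof -
    obtain y z where yz: "y \<in> span V" "\<And>w. w \<in> span V \<Longrightarrow> orthogonal z w" "x = y + z"
      using orthogonal_subspace_decomp_exists[of V x] by metis
    have "?P x y"
      using yz assms by (auto simp: orthogonal_comp_def orthogonal_commute span_superset
          span_eq_iff[THEN iffD2])
    then show ?thesis by blast
  qed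
  have f: "?P x (f x)" for x
    unfolding f_def using theI'[of "?P x"] ex uniq by blast
  have "linear f"
  proof (rule linearI)
    fix x y
    have "?P (x + y) (f x + f y)"
      using f[of x] f[of y] assms
        subspace_add[OF subspace_orthogonal_comp, of "x - f x" V "y - f y"]
      by (simp add: subspace_add add_diff_add)
    then show "f (x + y) = f x + f y" using uniq f by blast
  next
    fix c x
    have "?P (c *\<^sub>R x) (c *\<^sub>R f x)"
      using f[of x] assms
        subspace_scale[OF subspace_orthogonal_comp, of "x - f x" V c]
      by (simp add: subspace_scale scaleR_diff_right)
    then show "f (c *\<^sub>R x) = c *\<^sub>R f x" using uniq f by blast
  qed
  then have "orth_proj V *v x = f x"
    by (simp add: orth_proj_def f_def matrix_works)
  then show ?thesis using f by simp
qed

(* The norm is the Euclidean (Frobenius) norm of HOL-Analysis; the set JJ below does not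
   depend on the choice of norm. *)
definition normalized_cov :: "(real^'n) set \<Rightarrow> real^'n^'n \<Rightarrow> real^'n^'n" where
  "normalized_cov L \<Sigma> =
     (let S = orth_proj (L\<^sup>\<bottom>) ** \<Sigma> ** orth_proj (L\<^sup>\<bottom>) in (1 / norm S) *\<^sub>R S)"

definition JJ :: "(real^'n) set \<Rightarrow> (real^'n^'n) set \<Rightarrow> (real^'n) set set" where
  "JJ L \<CC> = {span (columns S) | S.
     S \<in> closure (normalized_cov L ` \<CC>) \<and> rank S < CARD('n) - dim L}"

(* The estimators are partial functions with domain -N; here they are total functions whose
   values on N are irrelevant. *)
definition estimator_conditions ::
  "real^'k^'n \<Rightarrow> (real^'n \<Rightarrow> real^'k) \<Rightarrow> (real^'n \<Rightarrow> real^'q^'q) \<Rightarrow> (real^'n) set \<Rightarrow> bool" where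
  "estimator_conditions X b \<Omega> N \<longleftrightarrow>
     continuous_on (- N) b \<and> continuous_on (- N) \<Omega> \<and>
     closed N \<and> N \<in> null_sets lborel \<and>
     (\<forall>y. y \<notin> N \<longrightarrow> symmetric_mat (\<Omega> y)) \<and>
     (\<forall>y \<delta> \<eta>. y \<notin> N \<longrightarrow> \<delta> \<noteq> 0 \<longrightarrow> \<delta> *\<^sub>R y + X *v \<eta> \<notin> N) \<and>
     (\<forall>y \<delta> \<eta>. y \<notin> N \<longrightarrow> \<delta> \<noteq> 0 \<longrightarrow>
        b (\<delta> *\<^sub>R y + X *v \<eta>) = \<delta> *\<^sub>R b y + \<eta> \<and>
        \<Omega> (\<delta> *\<^sub>R y + X *v \<eta>) = \<delta>\<^sup>2 *\<^sub>R \<Omega> y) \<and>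
     (AE y in lborel. y \<notin> N \<longrightarrow> invertible (\<Omega> y))"

definition F_type_stat ::
  "real^'k^'q \<Rightarrow> real^'q \<Rightarrow> (real^'n \<Rightarrow> real^'k) \<Rightarrow> (real^'n \<Rightarrow> real^'q^'q) \<Rightarrow> (real^'n) set \<Rightarrow>
     real^'n \<Rightarrow> real" where
  "F_type_stat R r b \<Omega> N y =
     (if y \<in> N \<union> {y. y \<notin> N \<and> det (\<Omega> y) = 0} then 0
      else (R *v b y - r) \<bullet> (matrix_inv (\<Omega> y) *v (R *v b y - r)))"

end

theory Submission
  imports Defs
begin

text \<open>
  Write the random vector as \<open>\<mu>0 + \<sigma> A z\<close> with \<open>\<Sigma> = A A'\<close> and \<open>z\<close> standard normal. Let \<open>\<Sigma>\<close> run through a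
  sequence whose normalized covariances converge to a singular limit with column space inside
  \<open>span(X)\<close>. The correspondingly projected and scaled factors \<open>D\<close> of the normalized covariances are
  bounded, so a subsequence converges to some \<open>D'\<close>; its range lies in \<open>span(X)\<close> and is orthogonal to
  \<open>M0_lin\<close>. Hence for almost every \<open>z\<close> the vectors \<open>\<mu>0 + D z\<close> approach a point \<open>X \<beta>\<close> with \<open>R \<beta> \<noteq> r\<close>,
  where \<open>\<Omega>\<close> vanishes by equivariance, so by invariance the statistic tends to infinity pointwise
  almost everywhere. Dominated convergence under the fixed law of \<open>z\<close> gives the claim, with no
  appeal to weak convergence.
\<close>

section \<open>Linear substitution in Lebesgue integrals\<close>

text \<open>By Tonelli, coordinate \<open>m\<close> may be integrated first. With the other
  coordinates fixed, the shear translates it by the constant \<open>x $ n\<close>, constant because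
  \<open>m \<noteq> n\<close>, and one-dimensional Lebesgue measure is translation
  invariant.\<close>

lemma nn_integral_shear:
  fixes g :: "real^'n \<Rightarrow> ennreal"
  assumes [measurable]: "g \<in> borel_measurable borel" and "m \<noteq> n"
  shows "(\<integral>\<^sup>+ x. g (\<chi> i. if i = m then x $ m + x $ n else x $ i) \<partial>lborel) = (\<integral>\<^sup>+ x. g x \<partial>lborel)"
proof -
  let ?s = "\<lambda>x::real^'n. \<chi> i. if i = m then x $ m + x $ n else x $ i"
  let ?B = "Basis :: (real^'n) set"
  let ?e = "\<lambda>f::real^'n \<Rightarrow> real. \<Sum>b\<in>?B. f b *\<^sub>R b"
  let ?a = "axis m (1::real)" and ?c = "axis n (1::real)"
  interpret product_sigma_finite "\<lambda>_::real^'n. lborel :: real measure" ..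
  have s_eq: "?s x = x + (x $ n) *\<^sub>R axis m 1" for x
    by (auto simp: vec_eq_iff axis_def)
  have [measurable]: "?s \<in> borel \<rightarrow>\<^sub>M borel"
    unfolding s_eq by (intro borel_measurable_continuous_onI continuous_intros)
  have a: "?a \<in> ?B" and c: "?c \<in> ?B" by (auto simp: axis_in_Basis_iff)
  have ac: "?c \<noteq> ?a" using \<open>m \<noteq> n\<close> by (simp add: axis_eq_axis)
  define I where "I = ?B - {?a}"
  have I: "?B = insert ?a I" "finite I" "?a \<notin> I" "?c \<in> I"
    using a c ac by (auto simp: I_def)
  have e_n: "?e f $ n = f ?c" for f
  proof -
    have "?e f $ n = ?e f \<bullet> ?c" by (simp add: inner_axis)
    also have "\<dots> = f ?c" using c by (simp add: inner_sum_left inner_Basis if_distrib cong: if_cong)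
    finally show ?thesis .
  qed
  have e_upd: "?e (x(?a := y + t)) = ?e (x(?a := y)) + t *\<^sub>R ?a" for x y t
    using I by (simp add: I(1) algebra_simps cong: sum.cong)
      (smt (verit, best) sum.cong)
  have shear: "?s (?e (x(?a := y))) = ?e (x(?a := y + x ?c))" for x y
    by (subst s_eq) (simp only: e_n e_upd fun_upd_other[OF ac])
  have inner: "(\<integral>\<^sup>+ y. g (?s (?e (x(?a := y)))) \<partial>lborel) = (\<integral>\<^sup>+ y. g (?e (x(?a := y))) \<partial>lborel)" for x
  proof -
    have e0: "(\<lambda>y. ?e (x(?a := y))) = (\<lambda>y. ?e (x(?a := 0)) + y *\<^sub>R ?a)"
      by (rule ext) (rule e_upd[of x 0, unfolded add_0])
    have [measurable]: "(\<lambda>y. ?e (x(?a := y))) \<in> borel \<rightarrow>\<^sub>M borel"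
      unfolding e0 by (intro borel_measurable_continuous_onI continuous_intros)
    have "(\<integral>\<^sup>+ y. g (?e (x(?a := y))) \<partial>lborel) = (\<integral>\<^sup>+ y. g (?e (x(?a := x ?c + 1 * y))) \<partial>lborel)"
      using nn_integral_real_affine[of "\<lambda>y. g (?e (x(?a := y)))" 1 "x ?c"] by simp
    then show ?thesis
      unfolding shear by (simp only: mult_1 add.commute[of "x ?c"])
  qed
  have *: "(\<integral>\<^sup>+ x. h x \<partial>lborel) = (\<integral>\<^sup>+ x. (\<integral>\<^sup>+ y. h (?e (x(?a := y))) \<partial>lborel) \<partial>(Pi\<^sub>M I (\<lambda>_. lborel)))"
    if [measurable]: "h \<in> borel_measurable borel" for h :: "real^'n \<Rightarrow> ennreal"
  proof -
    have "(\<integral>\<^sup>+ x. h x \<partial>lborel) = (\<integral>\<^sup>+ x. h (?e x) \<partial>(Pi\<^sub>M ?B (\<lambda>_. lborel)))"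
      by (subst lborel_eq, subst nn_integral_distr) auto
    also have "\<dots> = (\<integral>\<^sup>+ x. (\<integral>\<^sup>+ y. h (?e (x(?a := y))) \<partial>lborel) \<partial>(Pi\<^sub>M I (\<lambda>_. lborel)))"
    proof -
      have "(\<lambda>x. h (?e x)) \<in> borel_measurable (Pi\<^sub>M ?B (\<lambda>_. lborel))" by measurable
      then show ?thesis
        using product_nn_integral_insert[OF I(2,3), of "\<lambda>x. h (?e x)"] unfolding I(1)[symmetric] by simp
    qed
    finally show ?thesis .
  qed
  show ?thesis
    by (subst (1 2) *) (simp_all add: inner)
qed

text \<open>The change of variables theorems of HOL-Analysis require a well-ordered index type.\<close>

lemma nn_integral_linear_substitution:
  fixes f :: "real^'n \<Rightarrow> real^'n" and g :: "real^'n \<Rightarrow> ennreal"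
  assumes "linear f" "det (matrix f) \<noteq> 0" "g \<in> borel_measurable borel"
  shows "(\<integral>\<^sup>+ x. g x \<partial>lborel) = ennreal \<bar>det (matrix f)\<bar> * (\<integral>\<^sup>+ x. g (f x) \<partial>lborel)"
proof -
  \<comment> \<open>The quantifier over all \<open>g\<close> is needed for compositions, where the
    two hypotheses are applied to different integrands, \<open>h\<close> and
    \<open>\<lambda>x. h (f x)\<close>. The premise on the determinant makes the case of a vanishing
    coordinate vacuous.\<close>
  let ?P = "\<lambda>f::real^'n \<Rightarrow> real^'n. det (matrix f) \<noteq> 0 \<longrightarrow> (\<forall>g\<in>borel_measurable borel.
    (\<integral>\<^sup>+ x. g x \<partial>lborel) = ennreal \<bar>det (matrix f)\<bar> * (\<integral>\<^sup>+ x. g (f x) \<partial>lborel))"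
  have "?P f"
  proof (rule induct_linear_elementary[OF \<open>linear f\<close>])
    fix f g :: "real^'n \<Rightarrow> real^'n"
    assume lin: "linear f" "linear g" and f: "?P f" and g: "?P g"
    have [measurable]: "f \<in> borel \<rightarrow>\<^sub>M borel"
      using lin by (intro borel_measurable_continuous_onI linear_continuous_on)
        (simp add: linear_conv_bounded_linear)
    have m: "matrix (f \<circ> g) = matrix f ** matrix g"
      using matrix_compose[OF lin(2,1)] .
    show "?P (f \<circ> g)"
    proof (intro impI ballI)
      fix h :: "real^'n \<Rightarrow> ennreal"
      assume d: "det (matrix (f \<circ> g)) \<noteq> 0" and [measurable]: "h \<in> borel_measurable borel"
      from d have "det (matrix f) \<noteq> 0" "det (matrix g) \<noteq> 0" by (auto simp: m det_mul)
      then show "(\<integral>\<^sup>+ x. h x \<partial>lborel) =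
          ennreal \<bar>det (matrix (f \<circ> g))\<bar> * (\<integral>\<^sup>+ x. h ((f \<circ> g) x) \<partial>lborel)"
        using f[rule_format, of h] g[rule_format, of "\<lambda>x. h (f x)"]
        by (simp add: m det_mul abs_mult ennreal_mult' mult.assoc)
    qed
  next
    fix f :: "real^'n \<Rightarrow> real^'n" and i
    assume "linear f" and 0: "\<And>x. f x $ i = 0"
    then have "\<not> inj f"
      by (metis (full_types) linear_injective_imp_surjective one_neq_zero surjE vec_component)
    then show "?P f" using det_nz_iff_inj[OF \<open>linear f\<close>] by blast
  next
    fix c :: "'n \<Rightarrow> real"
    let ?f = "\<lambda>x::real^'n. \<chi> i. c i * x $ i"
    have d: "det (matrix ?f) = prod c UNIV"
      by (simp add: matrix_def axis_def det_diagonal)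
    show "?P ?f"
    proof (intro impI ballI)
      fix h :: "real^'n \<Rightarrow> ennreal"
      assume "det (matrix ?f) \<noteq> 0" and [measurable]: "h \<in> borel_measurable borel"
      then have nz: "c i \<noteq> 0" for i by (simp add: d)
      \<comment> \<open>The affine formula for \<open>lborel\<close> indexes scale factors by basis
        vectors; \<open>c'\<close> carries \<open>c\<close> over along the bijection between indices
        and basis vectors.\<close>
      define c' where "c' b = c (SOME i. b = axis i 1)" for b :: "real^'n"
      have c': "c' (axis i 1) = c i" for i by (simp add: c'_def axis_eq_axis)
      have B: "(Basis :: (real^'n) set) = range (\<lambda>i. axis i 1)"
        by (auto simp: Basis_vec_def)
      have inj: "inj (\<lambda>i::'n. axis i (1::real))"
        by (auto simp: inj_on_def axis_eq_axis)
      have T: "0 + (\<Sum>j\<in>Basis. (c' j * (x \<bullet> j)) *\<^sub>R j) = ?f x" for x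
        unfolding B by (subst sum.reindex[OF inj], simp add: c' inner_axis)
          (simp add: vec_eq_iff axis_def if_distrib cong: if_cong)
      have p: "(\<Prod>j\<in>Basis. \<bar>c' j\<bar>) = \<bar>prod c UNIV\<bar>"
        unfolding B by (subst prod.reindex[OF inj]) (simp add: c' abs_prod)
      have "c' j \<noteq> 0" if "j \<in> Basis" for j
        using that nz c' by (auto simp: B)
      from lborel_affine_euclidean[of c' 0, OF this]
      have L: "lborel = density (distr lborel borel ?f) (\<lambda>_. ennreal \<bar>prod c UNIV\<bar>)"
        unfolding T p by simp
      have [measurable]: "?f \<in> borel \<rightarrow>\<^sub>M borel"
        by (intro borel_measurable_continuous_onI continuous_on_vec_lambda continuous_intros)
      have "(\<integral>\<^sup>+ x. h x \<partial>lborel) = (\<integral>\<^sup>+ x. h x \<partial>density (distr lborel borel ?f) (\<lambda>_. ennreal \<bar>prod c UNIV\<bar>))"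
        using L by simp
      also have "\<dots> = ennreal \<bar>prod c UNIV\<bar> * (\<integral>\<^sup>+ x. h (?f x) \<partial>lborel)"
        by (simp add: nn_integral_density nn_integral_distr nn_integral_cmult)
      finally show "(\<integral>\<^sup>+ x. h x \<partial>lborel) = ennreal \<bar>det (matrix ?f)\<bar> * (\<integral>\<^sup>+ x. h (?f x) \<partial>lborel)"
        by (simp add: d)
    qed
  next
    fix m n :: 'n
    assume "m \<noteq> n"
    let ?t = "Transposition.transpose m n"
    let ?f = "\<lambda>x::real^'n. \<chi> i. x $ ?t i"
    have t: "?t permutes UNIV" by (simp add: permutes_swap_id)
    have "matrix ?f = (\<chi> i. mat 1 $ ?t i)"
      by (auto simp: matrix_def mat_def axis_def vec_eq_iff)
    then have d: "\<bar>det (matrix ?f)\<bar> = 1"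
      by (simp add: det_permute_rows[OF t] sign_swap_id \<open>m \<noteq> n\<close>)
    have [measurable]: "?f \<in> borel \<rightarrow>\<^sub>M borel"
      by (intro borel_measurable_continuous_onI continuous_on_vec_lambda continuous_intros)
    \<comment> \<open>A swap of coordinates maps boxes to boxes with the same side lengths, and
      boxes determine Lebesgue measure.\<close>
    have L: "lborel = distr lborel borel ?f"
    proof (rule lborel_eqI)
      fix l u :: "real^'n"
      assume le: "\<And>b. b \<in> Basis \<Longrightarrow> l \<bullet> b \<le> u \<bullet> b"
      then have le': "l $ i \<le> u $ i" for i
        using le[of "axis i 1"] by (simp add: inner_axis axis_in_Basis_iff)
      have "?f -` box l u = box (?f l) (?f u)"
        by (auto simp: mem_box_cart) (metis transpose_involutory)+
      moreover have "(\<Prod>b\<in>Basis. (?f u - ?f l) \<bullet> b) = (\<Prod>b\<in>Basis. (u - l) \<bullet> b)"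
      proof -
        have "(\<Prod>b\<in>Basis. (v::real^'n) \<bullet> b) = (\<Prod>i\<in>UNIV. v $ i)" for v
        proof -
          have B: "(Basis :: (real^'n) set) = range (\<lambda>i. axis i 1)" by (auto simp: Basis_vec_def)
          show ?thesis unfolding B
            by (subst prod.reindex) (auto simp: inj_on_def axis_eq_axis inner_axis)
        qed
        then show ?thesis
          using prod.permute[OF t, of "\<lambda>i. (u - l) $ i"] by (simp add: o_def)
      qed
      moreover have "?f l \<bullet> b \<le> ?f u \<bullet> b" if "b \<in> Basis" for b
        using that le' by (auto simp: Basis_vec_def inner_axis)
      ultimately show "emeasure (distr lborel borel ?f) (box l u) = (\<Prod>b\<in>Basis. (u - l) \<bullet> b)"
        by (simp add: emeasure_distr emeasure_lborel_box)
    qed simp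
    show "?P ?f"
    proof (intro impI ballI)
      fix h :: "real^'n \<Rightarrow> ennreal"
      assume [measurable]: "h \<in> borel_measurable borel"
      show "(\<integral>\<^sup>+ x. h x \<partial>lborel) = ennreal \<bar>det (matrix ?f)\<bar> * (\<integral>\<^sup>+ x. h (?f x) \<partial>lborel)"
        by (subst L) (simp add: d nn_integral_distr)
    qed
  next
    fix m n :: 'n
    assume "m \<noteq> n"
    let ?f = "\<lambda>x::real^'n. \<chi> i. if i = m then x $ m + x $ n else x $ i"
    \<comment> \<open>The shear is the identity matrix with row \<open>n\<close> added to row
      \<open>m\<close>, so its determinant is 1.\<close>
    have "matrix ?f = (\<chi> k. if k = m then row m (mat 1) + 1 *s row n (mat 1) else row k (mat 1))"
      using \<open>m \<noteq> n\<close> by (auto simp: matrix_def mat_def axis_def vec_eq_iff row_def)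
    then have "det (matrix ?f) = 1"
      using det_row_operation[OF \<open>m \<noteq> n\<close>, of "mat 1 :: real^'n^'n" 1] by simp
    then show "?P ?f"
      using nn_integral_shear[OF _ \<open>m \<noteq> n\<close>] by auto
  qed
  then show ?thesis using assms by blast
qed

section \<open>Gaussian measures as affine images of the standard one\<close>

text \<open>A largest set that is orthonormal for the form
  \<open>x \<bullet> (\<Sigma> *v y)\<close> is a basis. With its elements as the rows of
  \<open>M\<close>, the product \<open>M ** \<Sigma> ** transpose M\<close> is the identity, so the
  inverse of \<open>M\<close> serves as \<open>A\<close>.\<close>

lemma pos_def_factorization:
  fixes \<Sigma> :: "real^'n^'n"
  assumes "symmetric_mat \<Sigma>" "pos_def_mat \<Sigma>"
  obtains A :: "real^'n^'n" where "\<Sigma> = A ** transpose A" "invertible A"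
proof -
  let ?q = "\<lambda>x y. x \<bullet> (\<Sigma> *v y)"
  have sym: "?q x y = ?q y x" for x y
    using assms(1) unfolding symmetric_mat_def
    by (metis dot_lmul_matrix inner_commute vector_transpose_matrix)
  have pos: "0 < ?q x x" if "x \<noteq> 0" for x
    using assms(2) that by (simp add: pos_def_mat_def)
  define orth where "orth B \<longleftrightarrow> finite B \<and> (\<forall>x\<in>B. \<forall>y\<in>B. ?q x y = (if x = y then 1 else 0))" for B
  have coef: "?q b (\<Sum>v\<in>B. u v *\<^sub>R v) = u b" if "orth B" "b \<in> B" for B b u
  proof -
    have "?q b (\<Sum>v\<in>B. u v *\<^sub>R v) = (\<Sum>v\<in>B. u v * ?q b v)"
      by (simp add: linear_sum[OF matrix_vector_mul_linear] inner_sum_right matrix_vector_mult_scaleR)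
    also have "\<dots> = (\<Sum>v\<in>B. if v = b then u v else 0)"
      using that by (intro sum.cong) (auto simp: orth_def)
    also have "\<dots> = u b" using that by (simp add: orth_def)
    finally show ?thesis .
  qed
  have indep: "independent B" if "orth B" for B
  proof
    assume "dependent B"
    moreover have "finite B" using that by (simp add: orth_def)
    ultimately obtain u v where "v \<in> B" "u v \<noteq> 0" "(\<Sum>v\<in>B. u v *\<^sub>R v) = 0"
      unfolding dependent_finite[OF \<open>finite B\<close>] by blast
    then show False using coef[OF that, of v u] by simp
  qed
  have card: "card B \<le> CARD('n)" if "orth B" for B
    using independent_card_le_dim[OF subset_UNIV indep[OF that]] by simp
  have "orth {}" by (simp add: orth_def)
  moreover have "\<forall>B. orth B \<longrightarrow> card B < Suc CARD('n)" using card by (simp add: less_Suc_eq_le)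
  ultimately have "\<exists>B. orth B \<and> (\<forall>B'. orth B' \<longrightarrow> card B' \<le> card B)"
    by (rule Lattices_Big.ex_has_greatest_nat)
  then obtain B where B: "orth B" and max: "\<And>B'. orth B' \<Longrightarrow> card B' \<le> card B"
    by blast
  have "span B = UNIV"
  proof (rule ccontr)
    assume "span B \<noteq> UNIV"
    then obtain v where v: "v \<notin> span B" by blast
    \<comment> \<open>One Gram-Schmidt step: the normalized residual \<open>w'\<close> would enlarge
      \<open>B\<close>, against its maximality.\<close>
    define w where "w = v - (\<Sum>b\<in>B. ?q b v *\<^sub>R b)"
    have "w \<noteq> 0"
      using v span_sum[of B "\<lambda>b. ?q b v *\<^sub>R b" B] by (auto simp: w_def span_scale span_base)
    have wB: "?q b w = 0" if "b \<in> B" for b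
      using coef[OF B that, of "\<lambda>b. ?q b v"]
      by (simp add: w_def matrix_vector_mult_diff_distrib inner_diff_right)
    define w' where "w' = (1 / sqrt (?q w w)) *\<^sub>R w"
    have w'B: "?q b w' = 0" "?q w' b = 0" if "b \<in> B" for b
      using wB[OF that] sym[of w' b] by (simp_all add: w'_def matrix_vector_mult_scaleR)
    have w'w': "?q w' w' = 1"
      using pos[OF \<open>w \<noteq> 0\<close>] by (simp add: w'_def matrix_vector_mult_scaleR flip: power2_eq_square)
    have "w' \<notin> B" using w'B(1)[of w'] w'w' by auto
    moreover have "orth (insert w' B)"
      using B w'B w'w' \<open>w' \<notin> B\<close> by (auto simp: orth_def)
    ultimately show False
      using max[of "insert w' B"] B by (simp add: orth_def)
  qed
  then have "card B = CARD('n)"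
    using indep[OF B] by (metis dim_eq_card_independent dim_span dim_UNIV DIM_cart DIM_real mult.right_neutral)
  then obtain h :: "'n \<Rightarrow> real^'n" where h: "bij_betw h UNIV B"
    using finite_same_card_bij[of "UNIV::'n set" B] B by (auto simp: orth_def)
  define M :: "real^'n^'n" where "M = (\<chi> i. h i)"
  have "(M ** \<Sigma> ** transpose M) $ i $ j = ?q (h i) (h j)" for i j
  proof -
    have "(M ** \<Sigma> ** transpose M) $ i $ j = axis i 1 \<bullet> ((M ** \<Sigma> ** transpose M) *v axis j 1)"
      by (simp add: matrix_vector_mult_basis column_def inner_axis')
    also have "\<dots> = (transpose M *v axis i 1) \<bullet> (\<Sigma> *v (transpose M *v axis j 1))"
      by (simp flip: matrix_vector_mul_assoc add: dot_lmul_matrix[symmetric])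
    finally show ?thesis
      by (simp add: matrix_vector_mult_basis M_def row_def)
  qed
  moreover have "?q (h i) (h j) = mat 1 $ i $ j" for i j
    using B bij_betwE[OF h] bij_betw_imp_inj_on[OF h] by (auto simp: orth_def mat_def dest: injD)
  ultimately have M: "M ** \<Sigma> ** transpose M = mat 1"
    by (simp add: vec_eq_iff)
  then have "det M * (det \<Sigma> * det M) = 1"
    by (metis det_mul det_I det_transpose mult.assoc)
  then have "invertible M" by (auto simp: invertible_det_nz)
  then obtain A where A: "A ** M = mat 1" "M ** A = mat 1" by (auto simp: invertible_def)
  have "transpose M ** transpose A = mat 1"
    using A by (metis matrix_transpose_mul transpose_mat)
  then have "\<Sigma> = (A ** M) ** \<Sigma> ** (transpose M ** transpose A)"
    using A by simp
  also have "\<dots> = A ** (M ** \<Sigma> ** transpose M) ** transpose A"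
    by (simp add: matrix_mul_assoc)
  finally have "\<Sigma> = A ** transpose A" by (simp add: M)
  moreover have "invertible A" using A by (auto simp: invertible_def)
  ultimately show thesis by (rule that)
qed

lemma matrix_inv_right_left:
  fixes A :: "real^'n^'n"
  assumes "invertible A"
  shows "A ** matrix_inv A = mat 1" "matrix_inv A ** A = mat 1"
proof -
  have "A ** matrix_inv A = mat 1 \<and> matrix_inv A ** A = mat 1"
    unfolding matrix_inv_def by (rule someI_ex) (use assms in \<open>simp add: invertible_def\<close>)
  then show "A ** matrix_inv A = mat 1" "matrix_inv A ** A = mat 1" by blast+
qed

lemma matrix_inv_mat_1: "matrix_inv (mat 1 :: real^'n^'n) = mat 1"
  using matrix_inv_right_left(1)[of "mat 1 :: real^'n^'n"] by (simp add: invertible_det_nz)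

lemma borel_measurable_matrix_vector_mult [measurable]:
  "(\<lambda>x. A *v x) \<in> borel_measurable borel" for A :: "real^'n^'m"
  by (intro borel_measurable_continuous_onI linear_continuous_on matrix_vector_mul_bounded_linear)

text \<open>With \<open>B\<close> the inverse of \<open>M\<close>, the inverse of
  \<open>M ** transpose M\<close> times \<open>M\<close> is \<open>transpose B\<close>, and moving
  \<open>B\<close> to the other side of the inner product cancels \<open>M\<close>. This turns the
  exponent of the transformed density into the standard one.\<close>

lemma quadratic_form_inverse_transpose:
  fixes M :: "real^'n^'n"
  assumes "invertible M"
  shows "(M *v z) \<bullet> (matrix_inv (M ** transpose M) *v (M *v z)) = z \<bullet> z"
proof -
  obtain B where B: "M ** B = mat 1" "B ** M = mat 1"
    using assms by (auto simp: invertible_def)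
  have tr: "transpose M ** transpose B = mat 1" "transpose B ** transpose M = mat 1"
    using B by (metis matrix_transpose_mul transpose_mat)+
  have "invertible (M ** transpose M)"
    using assms by (simp add: invertible_det_nz det_mul)
  then have inv: "matrix_inv (M ** transpose M) ** (M ** transpose M) = mat 1"
    by (rule matrix_inv_right_left)
  have "(M ** transpose M) ** transpose B = M"
    using tr(1) by (metis matrix_mul_assoc matrix_mul_rid)
  then have "matrix_inv (M ** transpose M) ** M = transpose B"
    using inv by (metis matrix_mul_assoc matrix_mul_lid)
  then have "matrix_inv (M ** transpose M) *v (M *v z) = transpose B *v z"
    by (simp add: matrix_vector_mul_assoc)
  moreover have "(M *v z) \<bullet> (transpose B *v z) = z \<bullet> (B *v (M *v z))"
    by (metis dot_lmul_matrix inner_commute vector_transpose_matrix)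
  ultimately show ?thesis
    using B by (simp add: matrix_vector_mul_assoc)
qed

lemma sets_gaussian_measure [measurable_cong, simp]: "sets (gaussian_measure \<mu> A) = sets borel"
  and space_gaussian_measure [simp]: "space (gaussian_measure \<mu> A) = UNIV"
  by (simp_all add: gaussian_measure_def)

lemma AE_gaussian_measure:
  assumes "AE x in lborel. P x"
  shows "AE x in gaussian_measure \<mu> A. P x"
  unfolding gaussian_measure_def using assms
  by (subst AE_density) auto

text \<open>The density is the product of one-dimensional standard normal densities, so its integral
  factors into integrals equal to 1.\<close>

lemma prob_space_standard_gaussian: "prob_space (gaussian_measure (0::real^'n) (mat 1))"
proof -
  have dens: "exp (- (y \<bullet> y) / 2) / sqrt ((2 * pi) ^ CARD('n)) = (\<Prod>b\<in>Basis. std_normal_density (y \<bullet> b))"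
    for y :: "real^'n"
  proof -
    have "(\<Prod>b\<in>Basis. std_normal_density (y \<bullet> b)) =
        (\<Prod>b\<in>(Basis::(real^'n) set). 1 / sqrt (2 * pi)) * exp (\<Sum>b\<in>Basis. - (y \<bullet> b)\<^sup>2 / 2)"
      by (simp add: std_normal_density_def exp_sum del: prod_constant flip: prod.distrib)
    also have "(\<Sum>b\<in>Basis. - (y \<bullet> b)\<^sup>2 / 2) = - (y \<bullet> y) / 2"
      by (subst euclidean_inner[of y y]) (simp add: power2_eq_square sum_negf sum_divide_distrib)
    also have "(\<Prod>b\<in>(Basis::(real^'n) set). 1 / sqrt (2 * pi)) = 1 / sqrt ((2 * pi) ^ CARD('n))"
      by (simp add: power_divide real_sqrt_power real_sqrt_mult power_mult_distrib)
    finally show ?thesis by simp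
  qed
  have "emeasure (gaussian_measure (0::real^'n) (mat 1)) UNIV =
      (\<integral>\<^sup>+ y. (\<Prod>b\<in>Basis. ennreal (std_normal_density (y \<bullet> b))) \<partial>(lborel::(real^'n) measure))"
    by (simp add: gaussian_measure_def matrix_inv_mat_1 emeasure_density prod_ennreal flip: dens)
  also have "\<dots> = (\<Prod>b\<in>(Basis::(real^'n) set). \<integral>\<^sup>+ x. ennreal (std_normal_density x) \<partial>lborel)"
    by (rule nn_integral_lborel_prod) auto
  also have "\<dots> = 1"
    using prob_space.emeasure_space_1[OF prob_space_normal_density[of 1 0]]
    by (simp add: emeasure_density)
  finally show ?thesis by (intro prob_spaceI) simp
qed

text \<open>Substitute \<open>y = \<mu> + M *v z\<close> in the density, first as a translation and
  then as a linear map. This puts all laws under comparison on one fixed probability space.\<close>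

lemma gaussian_measure_eq_distr:
  fixes M :: "real^'n^'n"
  assumes "invertible M"
  shows "gaussian_measure \<mu> (M ** transpose M) =
    distr (gaussian_measure 0 (mat 1)) borel (\<lambda>z. \<mu> + M *v z)"
proof (rule measure_eqI)
  fix B assume "B \<in> sets (gaussian_measure \<mu> (M ** transpose M))"
  then have [measurable]: "B \<in> sets borel" by simp
  have d: "det M \<noteq> 0" using assms by (simp add: invertible_det_nz)
  let ?d = "\<lambda>y. ennreal (exp (- ((y - \<mu>) \<bullet> (matrix_inv (M ** transpose M) *v (y - \<mu>))) / 2) /
    sqrt ((2 * pi) ^ CARD('n) * det (M ** transpose M)))"
  let ?e = "\<lambda>z. ennreal (exp (- (z \<bullet> z) / 2) / sqrt ((2 * pi) ^ CARD('n)))"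
  have "emeasure (gaussian_measure \<mu> (M ** transpose M)) B = (\<integral>\<^sup>+ y. ?d y * indicator B y \<partial>lborel)"
    by (simp add: gaussian_measure_def emeasure_density)
  also have "\<dots> = (\<integral>\<^sup>+ y. ?d (\<mu> + y) * indicator B (\<mu> + y) \<partial>lborel)"
  proof -
    have "(lborel :: (real^'n) measure) = distr lborel borel ((+) \<mu>)"
      by (rule lborel_distr_plus[symmetric])
    then have "(\<integral>\<^sup>+ y. ?d y * indicator B y \<partial>lborel) = (\<integral>\<^sup>+ y. ?d y * indicator B y \<partial>distr lborel borel ((+) \<mu>))"
      by simp
    also have "\<dots> = (\<integral>\<^sup>+ y. ?d (\<mu> + y) * indicator B (\<mu> + y) \<partial>lborel)"
      by (rule nn_integral_distr) measurable
    finally show ?thesis .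
  qed
  also have "\<dots> = ennreal \<bar>det M\<bar> * (\<integral>\<^sup>+ z. ?d (\<mu> + M *v z) * indicator B (\<mu> + M *v z) \<partial>lborel)"
    using nn_integral_linear_substitution[of "(*v) M" "\<lambda>y. ?d (\<mu> + y) * indicator B (\<mu> + y)"] d
    by (simp add: matrix_of_matrix_vector_mul)
  also have "\<dots> = (\<integral>\<^sup>+ z. ennreal \<bar>det M\<bar> * (?d (\<mu> + M *v z) * indicator B (\<mu> + M *v z)) \<partial>lborel)"
    by (rule nn_integral_cmult[symmetric]) measurable
  also have "\<dots> = (\<integral>\<^sup>+ z. ?e z * indicator B (\<mu> + M *v z) \<partial>lborel)"
  proof (rule nn_integral_cong)
    fix z :: "real^'n"
    \<comment> \<open>The Jacobian \<open>\<bar>det M\<bar>\<close> cancels the square root of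
      \<open>det (M ** transpose M)\<close>, which is the square of \<open>det M\<close>.\<close>
    have "ennreal \<bar>det M\<bar> * ?d (\<mu> + M *v z) = ?e z"
      using d by (simp add: quadratic_form_inverse_transpose[OF assms] det_mul real_sqrt_mult
          flip: ennreal_mult')
    then show "ennreal \<bar>det M\<bar> * (?d (\<mu> + M *v z) * indicator B (\<mu> + M *v z)) =
        ?e z * indicator B (\<mu> + M *v z)"
      by (subst mult.assoc[symmetric]) simp
  qed
  also have "\<dots> = emeasure (distr (gaussian_measure 0 (mat 1)) borel (\<lambda>z. \<mu> + M *v z)) B"
  proof -
    have "(\<lambda>z. \<mu> + M *v z) \<in> borel \<rightarrow>\<^sub>M borel" by measurable
    from measurable_sets[OF this] have [measurable]: "(\<lambda>z. \<mu> + M *v z) -` B \<in> sets borel" by simp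
    have "emeasure (distr (gaussian_measure 0 (mat 1)) borel (\<lambda>z. \<mu> + M *v z)) B =
        emeasure (gaussian_measure 0 (mat 1)) ((\<lambda>z. \<mu> + M *v z) -` B)"
      by (subst emeasure_distr) auto
    also have "\<dots> = (\<integral>\<^sup>+ z. ?e z * indicator ((\<lambda>z. \<mu> + M *v z) -` B) z \<partial>lborel)"
      unfolding gaussian_measure_def by (subst emeasure_density) (auto simp: matrix_inv_mat_1)
    finally show ?thesis by (simp add: indicator_def vimage_def)
  qed
  finally show "emeasure (gaussian_measure \<mu> (M ** transpose M)) B =
    emeasure (distr (gaussian_measure 0 (mat 1)) borel (\<lambda>z. \<mu> + M *v z)) B" .
qed simp

section \<open>Measurability and growth of the test statistic\<close>

lemma continuous_on_det:
  fixes f :: "'a::topological_space \<Rightarrow> real^'n^'n"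
  assumes "continuous_on S f"
  shows "continuous_on S (\<lambda>x. det (f x))"
  unfolding det_def by (intro continuous_intros assms)

text \<open>Cramer's rule expresses the inverse through quotients of determinants that are
  continuous in \<open>y\<close>, so no regularity of \<open>matrix_inv\<close> itself has to be
  established.\<close>

lemma borel_measurable_F_type_stat:
  assumes b: "continuous_on UNIV b" and \<Omega>: "continuous_on UNIV \<Omega>"
  shows "F_type_stat R r b \<Omega> {} \<in> borel_measurable borel"
proof -
  define v where "v y = R *v b y - r" for y
  have v: "continuous_on UNIV v"
    unfolding v_def by (intro continuous_intros b linear_continuous_on_compose[OF b] matrix_vector_mul_linear)
  \<comment> \<open>Cramer numerators: column \<open>k\<close> of \<open>\<Omega> y\<close> is
    replaced by \<open>v y\<close>.\<close>
  define c where "c k y = det (\<chi> i j. if j = k then v y $ i else \<Omega> y $ i $ j)" for k y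
  have "continuous_on UNIV (c k)" for k
  proof -
    have "continuous_on UNIV (\<lambda>y. if j = k then v y $ i else \<Omega> y $ i $ j)" for i j
      by (cases "j = k") (auto intro!: continuous_intros v \<Omega>)
    then show ?thesis
      unfolding c_def by (intro continuous_on_det continuous_on_vec_lambda)
  qed
  then have [measurable]: "c k \<in> borel_measurable borel" for k
    by (rule borel_measurable_continuous_onI)
  have [measurable]: "(\<lambda>y. det (\<Omega> y)) \<in> borel_measurable borel"
    by (intro borel_measurable_continuous_onI continuous_on_det \<Omega>)
  have [measurable]: "(\<lambda>y. v y $ k) \<in> borel_measurable borel" for k
    by (intro borel_measurable_continuous_onI continuous_intros v)
  have inv: "matrix_inv (\<Omega> y) *v v y = (\<chi> k. c k y / det (\<Omega> y))" if "det (\<Omega> y) \<noteq> 0" for y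
  proof -
    have "\<Omega> y *v (matrix_inv (\<Omega> y) *v v y) = v y"
      using that by (simp add: matrix_vector_mul_assoc matrix_inv_right_left invertible_det_nz)
    then show ?thesis
      unfolding c_def cramer[OF that] .
  qed
  have "F_type_stat R r b \<Omega> {} =
      (\<lambda>y. if det (\<Omega> y) = 0 then 0 else \<Sum>k\<in>UNIV. v y $ k * (c k y / det (\<Omega> y)))"
    by (rule ext) (simp add: F_type_stat_def inner_vec_def inv flip: v_def)
  then show ?thesis by simp
qed

text \<open>The form is nonnegative along the line \<open>x + t *\<^sub>R y\<close>, which gives a
  nonnegative polynomial in \<open>t\<close> of degree at most two. As \<open>S\<close> may be
  singular, a vanishing leading coefficient is treated separately.\<close>

lemma nonneg_form_Cauchy_Schwarz:
  fixes S :: "real^'n^'n"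
  assumes "symmetric_mat S" "nonneg_def_mat S"
  shows "(x \<bullet> (S *v y))\<^sup>2 \<le> (x \<bullet> (S *v x)) * (y \<bullet> (S *v y))"
proof -
  let ?a = "x \<bullet> (S *v x)" and ?b = "x \<bullet> (S *v y)" and ?c = "y \<bullet> (S *v y)"
  have sym: "y \<bullet> (S *v x) = ?b"
    using assms(1) unfolding symmetric_mat_def
    by (metis dot_lmul_matrix inner_commute vector_transpose_matrix)
  have q: "0 \<le> ?a + 2 * t * ?b + t\<^sup>2 * ?c" for t
  proof -
    have "0 \<le> (x + t *\<^sub>R y) \<bullet> (S *v (x + t *\<^sub>R y))"
      using assms(2) by (simp add: nonneg_def_mat_def)
    also have "\<dots> = ?a + 2 * t * ?b + t\<^sup>2 * ?c"
      using sym by (simp add: matrix_vector_right_distrib matrix_vector_mult_scaleR inner_add_left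
          inner_add_right power2_eq_square algebra_simps)
    finally show ?thesis .
  qed
  show ?thesis
  proof (cases "?c = 0")
    case True
    have "?b = 0"
    proof (rule ccontr)
      assume "?b \<noteq> 0"
      \<comment> \<open>At this \<open>t\<close> the polynomial, affine here, takes the value
        -1.\<close>
      then show False using q[of "- (?a + 1) / (2 * ?b)"] True by (simp add: field_simps)
    qed
    then show ?thesis using True by simp
  next
    case False
    then have "0 < ?c" using assms(2) by (simp add: nonneg_def_mat_def order_less_le)
    moreover have "0 \<le> ?a - ?b\<^sup>2 / ?c"
      \<comment> \<open>The minimizer of the quadratic.\<close>
      using q[of "- ?b / ?c"] False by (simp add: power2_eq_square)
    ultimately show ?thesis by (simp add: field_simps)
  qed
qed

text \<open>Both sides scale with \<open>\<delta>^4\<close>, so the Cauchy--Schwarz bound for the statistic at \<open>y\<close>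
  can be read off at any equivalent point \<open>y'\<close>.\<close>

lemma F_type_stat_lower_bound:
  fixes X :: "real^'k^'n" and \<Omega> :: "real^'n \<Rightarrow> real^'q^'q"
  assumes est: "estimator_conditions X b \<Omega> {}" and nonneg: "\<And>y. nonneg_def_mat (\<Omega> y)"
    and "det (\<Omega> y) \<noteq> 0" and "\<delta> \<noteq> 0" and \<eta>: "R *v \<eta> = (1 - \<delta>) *\<^sub>R r"
  defines "y' \<equiv> \<delta> *\<^sub>R y + X *v \<eta>"
  defines "v' \<equiv> R *v b y' - r"
  shows "(v' \<bullet> v')\<^sup>2 \<le> F_type_stat R r b \<Omega> {} y * (v' \<bullet> (\<Omega> y' *v v'))"
proof -
  define v where "v = R *v b y - r"
  have by': "b y' = \<delta> *\<^sub>R b y + \<eta>" and \<Omega>y': "\<Omega> y' = \<delta>\<^sup>2 *\<^sub>R \<Omega> y"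
    using est \<open>\<delta> \<noteq> 0\<close> by (auto simp: estimator_conditions_def y'_def)
  \<comment> \<open>The condition on \<open>R *v \<eta>\<close> is exactly what keeps
    \<open>r\<close> fixed under the transformation, so that the discrepancy only scales by
    \<open>\<delta>\<close>.\<close>
  have v': "v' = \<delta> *\<^sub>R v"
    by (simp add: v'_def v_def by' matrix_vector_right_distrib matrix_vector_mult_scaleR \<eta>
        scaleR_diff_left scaleR_diff_right)
  define w where "w = matrix_inv (\<Omega> y) *v v"
  have w: "\<Omega> y *v w = v"
    using assms(3) by (simp add: w_def matrix_vector_mul_assoc matrix_inv_right_left invertible_det_nz)
  have "symmetric_mat (\<Omega> y)" using est by (simp add: estimator_conditions_def)
  \<comment> \<open>Since \<open>\<Omega> y *v w = v\<close>, the mixed term is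
    \<open>v \<bullet> v\<close>, and the form at \<open>w\<close> is \<open>v \<bullet> w\<close>,
    the value of the statistic at \<open>y\<close>.\<close>
  from nonneg_form_Cauchy_Schwarz[OF this nonneg, of v w]
  have "(v \<bullet> v)\<^sup>2 \<le> (v \<bullet> (\<Omega> y *v v)) * (v \<bullet> w)"
    by (simp add: w inner_commute)
  then have "\<delta>^4 * (v \<bullet> v)\<^sup>2 \<le> \<delta>^4 * ((v \<bullet> (\<Omega> y *v v)) * (v \<bullet> w))"
    by (rule mult_left_mono) simp
  moreover have "v' \<bullet> (\<Omega> y' *v v') = \<delta>^4 * (v \<bullet> (\<Omega> y *v v))"
    by (simp add: v' \<Omega>y' matrix_vector_mult_scaleR scaleR_matrix_vector_assoc[symmetric]
        power2_eq_square power4_eq_xxxx)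
  moreover have "(v' \<bullet> v')\<^sup>2 = \<delta>^4 * (v \<bullet> v)\<^sup>2"
    by (simp add: v' power2_eq_square power4_eq_xxxx)
  moreover have "F_type_stat R r b \<Omega> {} y = v \<bullet> w"
    using assms(3) by (simp add: F_type_stat_def v_def w_def)
  ultimately show ?thesis by (simp add: mult_ac)
qed

text \<open>Equivariance forces \<open>\<Omega>\<close> to vanish on the column space of \<open>X\<close> and \<open>b (X *v \<beta>) = \<beta>\<close>, so near a
  point of it violating the restriction the quadratic form in the lower bound is arbitrarily small
  while the left-hand side stays away from zero.\<close>

lemma eventually_F_type_stat_ge:
  fixes X :: "real^'k^'n" and \<Omega> :: "real^'n \<Rightarrow> real^'q^'q"
  assumes est: "estimator_conditions X b \<Omega> {}" and nonneg: "\<And>y. nonneg_def_mat (\<Omega> y)"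
    and nz: "\<And>m. det (\<Omega> (y m)) \<noteq> 0" "\<And>m. \<delta> m \<noteq> 0"
    and \<eta>: "\<And>m. R *v \<eta> m = (1 - \<delta> m) *\<^sub>R r"
    and lim: "(\<lambda>m. \<delta> m *\<^sub>R y m + X *v \<eta> m) \<longlonglongrightarrow> X *v \<beta>" and "R *v \<beta> \<noteq> r"
  shows "\<forall>\<^sub>F m in sequentially. C \<le> F_type_stat R r b \<Omega> {} (y m)"
proof -
  define y' where "y' m = \<delta> m *\<^sub>R y m + X *v \<eta> m" for m
  define v' where "v' m = R *v b (y' m) - r" for m
  have cb: "continuous_on UNIV b" and c\<Omega>: "continuous_on UNIV \<Omega>"
    using est by (auto simp: estimator_conditions_def)
  have hb: "b (\<delta> *\<^sub>R y + X *v \<eta>) = \<delta> *\<^sub>R b y + \<eta>"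
    and h\<Omega>: "\<Omega> (\<delta> *\<^sub>R y + X *v \<eta>) = \<delta>\<^sup>2 *\<^sub>R \<Omega> y" if "\<delta> \<noteq> 0" for \<delta> y \<eta>
    using est that by (auto simp: estimator_conditions_def)
  \<comment> \<open>Scaling the origin by 2 fixes it, so \<open>b 0\<close> equals its double and,
    below, \<open>\<Omega> 0\<close> equals four times itself.\<close>
  have "b 0 = 0" using hb[of 2 0 0] by (simp add: scaleR_2)
  then have b\<beta>: "b (X *v \<beta>) = \<beta>" using hb[of 1 0 \<beta>] by simp
  have "\<Omega> 0 = 0" using h\<Omega>[of 2 0 0] scaleR_cancel_right[of 4 "\<Omega> 0" 1] by auto
  then have \<Omega>\<beta>: "\<Omega> (X *v \<beta>) = 0" using h\<Omega>[of 1 0 \<beta>] by simp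
  have y': "y' \<longlonglongrightarrow> X *v \<beta>" using lim by (simp add: y'_def[abs_def])
  have "(\<lambda>m. b (y' m)) \<longlonglongrightarrow> \<beta>" "(\<lambda>m. \<Omega> (y' m)) \<longlonglongrightarrow> 0"
    using continuous_on_tendsto_compose[OF cb y'] continuous_on_tendsto_compose[OF c\<Omega> y']
    by (simp_all add: b\<beta> \<Omega>\<beta>)
  note lb = this(1) and l\<Omega> = this(2)
  have lv: "v' \<longlonglongrightarrow> R *v \<beta> - r"
    unfolding v'_def[abs_def] by (intro tendsto_intros bounded_linear.tendsto[OF matrix_vector_mul_bounded_linear] lb)
  have "(\<lambda>m. \<Omega> (y' m) *v v' m) \<longlonglongrightarrow> 0 *v u" if "v' \<longlonglongrightarrow> u" for u
    unfolding matrix_vector_mult_def by (intro tendsto_intros tendsto_vec_lambda l\<Omega> that)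
  from this[OF lv]
  have lq: "(\<lambda>m. C * (v' m \<bullet> (\<Omega> (y' m) *v v' m))) \<longlonglongrightarrow> C * ((R *v \<beta> - r) \<bullet> 0)"
    by (intro tendsto_intros lv) simp
  \<comment> \<open>In the limit the quadratic form vanishes and the fourth power of the norm of
    \<open>R *v \<beta> - r\<close> remains. Comparing products avoids dividing by the form and
    works for \<open>C\<close> of either sign.\<close>
  have "0 < ((R *v \<beta> - r) \<bullet> (R *v \<beta> - r))\<^sup>2 - C * ((R *v \<beta> - r) \<bullet> 0)"
    using \<open>R *v \<beta> \<noteq> r\<close> by simp
  moreover have "(\<lambda>m. (v' m \<bullet> v' m)\<^sup>2 - C * (v' m \<bullet> (\<Omega> (y' m) *v v' m)))
      \<longlonglongrightarrow> ((R *v \<beta> - r) \<bullet> (R *v \<beta> - r))\<^sup>2 - C * ((R *v \<beta> - r) \<bullet> 0)"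
    by (intro tendsto_diff lq tendsto_intros lv)
  ultimately have "\<forall>\<^sub>F m in sequentially. 0 < (v' m \<bullet> v' m)\<^sup>2 - C * (v' m \<bullet> (\<Omega> (y' m) *v v' m))"
    by (rule order_tendstoD(1)[rotated])
  then show ?thesis
  proof eventually_elim
    case (elim m)
    show ?case
    proof (rule ccontr)
      assume "\<not> C \<le> F_type_stat R r b \<Omega> {} (y m)"
      moreover have "0 \<le> v' m \<bullet> (\<Omega> (y' m) *v v' m)"
        using nonneg by (simp add: nonneg_def_mat_def)
      ultimately have "F_type_stat R r b \<Omega> {} (y m) * (v' m \<bullet> (\<Omega> (y' m) *v v' m)) \<le>
          C * (v' m \<bullet> (\<Omega> (y' m) *v v' m))"
        by (intro mult_right_mono) auto
      moreover have "(v' m \<bullet> v' m)\<^sup>2 \<le>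
          F_type_stat R r b \<Omega> {} (y m) * (v' m \<bullet> (\<Omega> (y' m) *v v' m))"
        using F_type_stat_lower_bound[OF est nonneg nz(1,2) \<eta>, of m m]
        by (simp add: v'_def y'_def)
      ultimately show False using elim by simp
    qed
  qed
qed

section \<open>Limits of matrix factors, projections and kernels\<close>

text \<open>The diagonal of \<open>D m ** transpose (D m)\<close> holds the squared row norms of
  \<open>D m\<close>, so convergent Gram matrices have bounded factors. Compactness then yields a
  limit, and continuity of the product identifies its Gram matrix.\<close>

lemma convergent_subsequence_of_factors:
  fixes D :: "nat \<Rightarrow> real^'n^'n"
  assumes lim: "(\<lambda>m. D m ** transpose (D m)) \<longlonglongrightarrow> S"
  obtains s D' where "strict_mono s" "(D \<circ> s) \<longlonglongrightarrow> D'" "D' ** transpose D' = S"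
proof -
  obtain K where K: "norm (D m ** transpose (D m)) \<le> K" for m
    using convergent_imp_Bseq[OF convergentI[OF lim]] by (auto simp: Bseq_def)
  have "norm (D m) \<le> real CARD('n) * sqrt K" for m
  proof -
    have row: "norm (D m $ i) \<le> sqrt K" for i
    proof -
      have "(norm (D m $ i))\<^sup>2 = (D m ** transpose (D m)) $ i $ i"
        by (simp add: power2_norm_eq_inner matrix_mult_transpose_dot_row row_def)
      also have "\<dots> \<le> norm ((D m ** transpose (D m)) $ i)"
        using component_le_norm_cart[of _ i] abs_le_D1 by blast
      also have "\<dots> \<le> norm (D m ** transpose (D m))"
        by (rule Finite_Cartesian_Product.norm_nth_le)
      also have "\<dots> \<le> K" by (rule K)
      finally show ?thesis by (rule real_le_rsqrt)
    qed
    have "norm (D m) \<le> (\<Sum>i\<in>UNIV. norm (D m $ i))"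
      unfolding norm_vec_def by (rule L2_set_le_sum) simp
    also have "\<dots> \<le> real CARD('n) * sqrt K"
      using sum_bounded_above[of UNIV "\<lambda>i. norm (D m $ i)" "sqrt K"] row by simp
    finally show ?thesis .
  qed
  then have "bounded (range D)" by (auto simp: bounded_iff)
  then obtain D' s where s: "strict_mono s" "(D \<circ> s) \<longlonglongrightarrow> D'"
    using bounded_imp_convergent_subsequence by blast
  have "(\<lambda>m. (D \<circ> s) m ** transpose ((D \<circ> s) m)) \<longlonglongrightarrow> D' ** transpose D'"
    unfolding matrix_matrix_mult_def transpose_def by (intro tendsto_intros tendsto_vec_lambda s(2))
  moreover have "(\<lambda>m. (D \<circ> s) m ** transpose ((D \<circ> s) m)) \<longlonglongrightarrow> S"
    using LIMSEQ_subseq_LIMSEQ[OF lim s(1)] by (simp add: o_def)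
  ultimately have "D' ** transpose D' = S" by (rule LIMSEQ_unique)
  then show thesis using that s by blast
qed

text \<open>Let \<open>e\<close> be the part of \<open>D *v z\<close> orthogonal to the column space
  of the Gram matrix. Then \<open>e \<bullet> (?S *v e) = 0\<close> is the squared norm of
  \<open>transpose D *v e\<close>, so \<open>e\<close> is orthogonal to \<open>D *v z\<close> and
  therefore to itself.\<close>

lemma range_subset_span_gram_columns:
  fixes D :: "real^'n^'n"
  shows "D *v z \<in> span (columns (D ** transpose D))"
proof -
  let ?S = "D ** transpose D"
  obtain p e where pe: "p \<in> span (columns ?S)" "\<And>w. w \<in> span (columns ?S) \<Longrightarrow> orthogonal e w"
    "D *v z = p + e"
    using orthogonal_subspace_decomp_exists[of "columns ?S" "D *v z"] by metis
  have "e \<bullet> (?S *v e) = 0"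
    using pe(2)[OF matrix_vector_mult_in_columnspace] by (simp add: orthogonal_def)
  moreover have adj: "e \<bullet> (D *v u) = (transpose D *v e) \<bullet> u" for u
    by (metis dot_lmul_matrix transpose_matrix_vector)
  ultimately have "transpose D *v e = 0"
    by (simp flip: matrix_vector_mul_assoc)
  then have "e \<bullet> (p + e) = 0"
    using adj[of z] pe(3) by simp
  then have "e = 0"
    using pe(2)[OF pe(1)] by (simp add: inner_add_right orthogonal_def)
  then show ?thesis using pe by simp
qed

text \<open>Residuals are orthogonal to the range, so \<open>(?P *v x) \<bullet> y\<close> equals
  \<open>(?P *v x) \<bullet> (?P *v y)\<close>, which is symmetric in \<open>x\<close> and
  \<open>y\<close>.\<close>

lemma transpose_orth_proj:
  fixes V :: "(real^'n) set"
  assumes "subspace V"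
  shows "transpose (orth_proj V) = orth_proj V"
proof -
  let ?P = "orth_proj V"
  have "(?P *v x) \<bullet> (y - ?P *v y) = 0" for x y
    using orth_proj_works[OF assms, of x] orth_proj_works[OF assms, of y]
    by (auto simp: orthogonal_comp_def orthogonal_def)
  then have "(?P *v x) \<bullet> y = (?P *v x) \<bullet> (?P *v y)" for x y
    by (simp add: inner_diff_right)
  then have "(?P *v x) \<bullet> y = x \<bullet> (?P *v y)" for x y
    by (metis inner_commute)
  then have "(transpose ?P *v x) \<bullet> y = (?P *v x) \<bullet> y" for x y
    by (metis dot_lmul_matrix transpose_matrix_vector)
  then show ?thesis
    by (metis matrix_eq vector_eq_rdot)
qed

lemma span_columns_eq_range:
  fixes A :: "real^'n^'m"
  shows "span (columns A) = range ((*v) A)"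
proof
  have "subspace (range ((*v) A))"
    by (simp add: linear_subspace_image)
  then show "span (columns A) \<subseteq> range ((*v) A)"
    by (intro span_minimal) (auto simp: columns_image_basis)
qed (auto simp: matrix_vector_mult_in_columnspace)

lemma subspace_M0_lin: "subspace (M0_lin X R)"
proof -
  have "M0_lin X R = (*v) X ` {\<beta>. R *v \<beta> = 0}" by (auto simp: M0_lin_def)
  moreover have "subspace {\<beta>. R *v \<beta> = 0}"
    by (rule linear_subspace_kernel) (rule matrix_vector_mul_linear)
  ultimately show ?thesis
    by (simp add: linear_subspace_image)
qed

lemma M0_lin_subset_span_columns: "M0_lin X R \<subseteq> span (columns X)"
  by (auto simp: M0_lin_def matrix_vector_mult_in_columnspace)

text \<open>Guarantees that \<open>normalized_cov\<close> never divides by zero: the projection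
  fixes a nonzero \<open>x\<close> of \<open>V\<close>, on which the sandwiched form agrees with
  that of \<open>\<Sigma>\<close>.\<close>

lemma norm_orth_proj_sandwich_pos:
  fixes V :: "(real^'n) set"
  assumes "subspace V" "V \<noteq> {0}" "pos_def_mat \<Sigma>"
  shows "0 < norm (orth_proj V ** \<Sigma> ** orth_proj V)"
proof -
  let ?P = "orth_proj V"
  obtain x where x: "x \<in> V" "x \<noteq> 0"
    using assms(1,2) subspace_0 by blast
  have "x - ?P *v x \<in> V \<inter> V\<^sup>\<bottom>"
    using orth_proj_works[OF assms(1), of x] x(1) by (auto simp: assms(1) subspace_diff)
  then have Px: "?P *v x = x"
    using orthogonal_Int_0[OF assms(1)] by simp
  have "x \<bullet> ((?P ** \<Sigma> ** ?P) *v x) = (transpose ?P *v x) \<bullet> (\<Sigma> *v (?P *v x))"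
    by (metis dot_lmul_matrix transpose_matrix_vector matrix_vector_mul_assoc)
  also have "\<dots> = x \<bullet> (\<Sigma> *v x)"
    by (simp add: transpose_orth_proj[OF assms(1)] Px)
  also have "\<dots> > 0"
    using assms(3) x(2) by (simp add: pos_def_mat_def)
  finally show ?thesis by auto
qed

lemma null_sets_kernel:
  fixes A :: "real^'n^'m"
  assumes "A \<noteq> 0"
  shows "{x. A *v x = 0} \<in> null_sets lborel"
proof -
  let ?K = "{x. A *v x = 0}"
  have sub: "subspace ?K"
    by (rule linear_subspace_kernel) (rule matrix_vector_mul_linear)
  have "?K \<noteq> UNIV"
  proof
    assume "?K = UNIV"
    then have "A *v x = 0 *v x" for x by auto
    then show False using assms by (metis matrix_eq)
  qed
  then have "dim ?K < DIM(real^'n)"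
    using sub by (metis dim_eq_full dim_subset_UNIV order_less_le span_eq_iff)
  then have "?K \<in> null_sets lebesgue"
    by (simp add: negligible_lowdim flip: negligible_iff_null_sets)
  \<comment> \<open>Closedness makes the kernel a Borel set, so that nullity passes from the
    completion to \<open>lborel\<close>.\<close>
  moreover have "closed ?K" using sub by (rule closed_subspace)
  ultimately show ?thesis
    by (auto simp: null_sets_def emeasure_completion)
qed

section \<open>Rejection probabilities along a sequence of covariances\<close>

theorem theorem3p1:
  fixes X :: "real^'k^'n" and R :: "real^'k^'q" and r :: "real^'q"
    and \<CC> :: "(real^'n^'n) set"
    and b :: "real^'n \<Rightarrow> real^'k" and \<Omega> :: "real^'n \<Rightarrow> real^'q^'q"
    and T :: "real^'n \<Rightarrow> real"
    and C \<sigma>2 :: real and \<mu>0 :: "real^'n"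
  assumes "CARD('k) < CARD('n)"
    and "rank X = CARD('k)"
    and "rank R = CARD('q)"
    and "covariance_model \<CC>"
    and "estimator_conditions X b \<Omega> {}"
    and "T = F_type_stat R r b \<Omega> {}"
    and "\<And>y. nonneg_def_mat (\<Omega> y)"
    and "\<exists>S \<in> JJ (M0_lin X R) \<CC>. S \<subseteq> span (columns X)"
    and "\<mu>0 \<in> M0 X R r"
    and "0 < \<sigma>2"
  shows "(SUP \<Sigma>\<in>\<CC>. measure (gaussian_measure \<mu>0 (\<sigma>2 *\<^sub>R \<Sigma>)) {y. T y \<ge> C}) = 1"
proof -
  note est = assms(5) and T = assms(6) and nonneg = assms(7)
  let ?L = "M0_lin X R"
  let ?V = "?L\<^sup>\<bottom>"
  let ?P = "orth_proj ?V"
  let ?\<gamma> = "gaussian_measure (0::real^'n) (mat 1)"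
  interpret \<gamma>: prob_space ?\<gamma> by (rule prob_space_standard_gaussian)
  have L: "subspace ?L" by (rule subspace_M0_lin)
  have V: "subspace ?V" by (rule subspace_orthogonal_comp)
  \<comment> \<open>As \<open>k < n\<close>, the orthogonal complement \<open>?V\<close> is
    nontrivial, which the positivity of the normalizing norms requires.\<close>
  have "dim ?L < CARD('n)"
    using dim_subset[OF M0_lin_subset_span_columns, of X R] assms(1,2)
    by (simp add: column_rank_def)
  then have "?L \<noteq> UNIV" by auto
  then have "?V \<noteq> {0}"
    using orthogonal_comp_self[OF L] orthogonal_comp_null by metis
  obtain \<beta>0 where \<beta>0: "\<mu>0 = X *v \<beta>0" "R *v \<beta>0 = r"
    using assms(9) by (auto simp: M0_def)
  have [measurable]: "T \<in> borel_measurable borel"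
    using est by (simp add: T estimator_conditions_def borel_measurable_F_type_stat)
  have [measurable]: "{y. C \<le> T y} \<in> sets borel" by measurable

  \<comment> \<open>The sample as a function of the standard normal \<open>z\<close> and a factor
    \<open>A\<close> of the covariance.\<close>
  define E where "E z A = (\<mu>0 + (sqrt \<sigma>2 *\<^sub>R A) *v z)" for z :: "real^'n" and A :: "real^'n^'n"
  have [measurable]: "(\<lambda>z. E z A) \<in> borel \<rightarrow>\<^sub>M borel" for A
    unfolding E_def by measurable
  have gauss: "gaussian_measure \<mu>0 (\<sigma>2 *\<^sub>R \<Sigma>) = distr ?\<gamma> borel (\<lambda>z. E z A)"
    if "\<Sigma> = A ** transpose A" "invertible A" for A \<Sigma>
  proof -
    have "\<sigma>2 *\<^sub>R \<Sigma> = (sqrt \<sigma>2 *\<^sub>R A) ** transpose (sqrt \<sigma>2 *\<^sub>R A)"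
      using that(1) \<open>0 < \<sigma>2\<close>
      by (simp add: transpose_scalar matrix_scalar_ac scalar_matrix_assoc[symmetric])
    moreover have "invertible (sqrt \<sigma>2 *\<^sub>R A)"
      using that(2) \<open>0 < \<sigma>2\<close> by (simp add: scalar_invertible)
    ultimately show ?thesis
      unfolding E_def by (simp only: gaussian_measure_eq_distr)
  qed
  have factor: "\<exists>A :: real^'n^'n. \<Sigma> = A ** transpose A \<and> invertible A" if "\<Sigma> \<in> \<CC>" for \<Sigma>
  proof -
    have "symmetric_mat \<Sigma>" "pos_def_mat \<Sigma>"
      using assms(4) that by (simp_all add: covariance_model_def)
    then show ?thesis by (rule pos_def_factorization) blast
  qed

  \<comment> \<open>Sequence of covariances and limiting factor\<close>
  obtain S where S: "S \<in> closure (normalized_cov ?L ` \<CC>)" "span (columns S) \<subseteq> span (columns X)"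
    using assms(8) by (auto simp: JJ_def)
  then obtain N where N: "\<And>m. N m \<in> normalized_cov ?L ` \<CC>" "N \<longlonglongrightarrow> S"
    by (auto simp: closure_sequential)
  then have "\<exists>\<Sigma>. \<forall>m. \<Sigma> m \<in> \<CC> \<and> N m = normalized_cov ?L (\<Sigma> m)"
    by (intro choice) blast
  then obtain \<Sigma> where \<Sigma>: "\<And>m. \<Sigma> m \<in> \<CC>" "\<And>m. N m = normalized_cov ?L (\<Sigma> m)"
    by blast
  have "\<exists>A :: nat \<Rightarrow> real^'n^'n. \<forall>m. \<Sigma> m = A m ** transpose (A m) \<and> invertible (A m)"
    by (intro choice allI factor \<Sigma>)
  then obtain A :: "nat \<Rightarrow> real^'n^'n" where A: "\<And>m. \<Sigma> m = A m ** transpose (A m)" "\<And>m. invertible (A m)"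
    by blast
  \<comment> \<open>A factor enters its Gram matrix twice, hence the square root of the normalizing
    constant.\<close>
  define c where "c m = 1 / sqrt (norm (?P ** \<Sigma> m ** ?P))" for m
  have norm_pos: "0 < norm (?P ** \<Sigma> m ** ?P)" for m
    using norm_orth_proj_sandwich_pos[OF V \<open>?V \<noteq> {0}\<close>] assms(4) \<Sigma>(1)[of m]
    by (auto simp: covariance_model_def)
  have c: "0 < c m" for m
    using norm_pos[of m] by (simp add: c_def)
  \<comment> \<open>Modulo \<open>M0_lin X R\<close> and scaling, which act trivially on the statistic, \<open>A m\<close> may be
    replaced by \<open>D m\<close>, whose Gram matrix is the normalized covariance.\<close>
  define D where "D m = c m *\<^sub>R (?P ** A m)" for m
  have DN: "D m ** transpose (D m) = N m" for m
  proof -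
    have "D m ** transpose (D m) = (c m * c m) *\<^sub>R (?P ** (A m ** transpose (A m)) ** ?P)"
      by (simp add: D_def transpose_scalar matrix_transpose_mul transpose_orth_proj[OF V]
          matrix_mul_assoc matrix_scalar_ac scalar_matrix_assoc[symmetric])
    moreover have "c m * c m = 1 / norm (?P ** \<Sigma> m ** ?P)"
      using norm_pos[of m] by (simp add: c_def)
    ultimately show ?thesis
      by (simp add: \<Sigma>(2) normalized_cov_def Let_def flip: A(1))
  qed
  obtain s D' where s: "strict_mono s" "(D \<circ> s) \<longlonglongrightarrow> D'" "D' ** transpose D' = S"
    using convergent_subsequence_of_factors[of D S] N(2) by (auto simp: DN)
  \<comment> \<open>Unit norm survives the limit, so \<open>S\<close>, and with it
    \<open>D'\<close>, cannot vanish.\<close>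
  have "norm (N m) = 1" for m
    using norm_pos[of m] by (simp add: \<Sigma>(2) normalized_cov_def Let_def)
  then have "norm S = 1"
    using tendsto_norm[OF N(2)] by (simp add: LIMSEQ_const_iff)
  moreover have "(0 :: real^'n^'n) ** B = 0" for B :: "real^'n^'n"
    by (simp add: matrix_matrix_mult_def vec_eq_iff)
  ultimately have "D' \<noteq> 0"
    using s(3) by auto

  \<comment> \<open>Almost sure divergence of the statistic\<close>
  have "{z. D' *v z = 0} \<in> null_sets lborel"
    using \<open>D' \<noteq> 0\<close> by (rule null_sets_kernel)
  then have "AE z in lborel. D' *v z \<noteq> 0"
    using AE_not_in by fastforce
  then have ae_D: "AE z in ?\<gamma>. D' *v z \<noteq> 0"
    by (rule AE_gaussian_measure)
  have [measurable]: "(\<lambda>y. det (\<Omega> y)) \<in> borel_measurable borel"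
    using est by (intro borel_measurable_continuous_onI continuous_on_det)
      (simp add: estimator_conditions_def)
  \<comment> \<open>The exceptional set is Lebesgue null, hence null under each of these Gaussian
    laws; the distribution formula pulls this back to \<open>z\<close>.\<close>
  have ae_det: "AE z in ?\<gamma>. det (\<Omega> (E z (A m))) \<noteq> 0" for m
  proof -
    have "AE y in lborel. det (\<Omega> y) \<noteq> 0"
      using est by (simp add: estimator_conditions_def invertible_det_nz)
    then have "AE y in gaussian_measure \<mu>0 (\<sigma>2 *\<^sub>R \<Sigma> m). det (\<Omega> y) \<noteq> 0"
      by (rule AE_gaussian_measure)
    then show ?thesis
      unfolding gauss[OF A] by (subst (asm) AE_distr_iff) auto
  qed
  have ev: "\<forall>\<^sub>F m in sequentially. C \<le> T (E z (A (s m)))"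
    if z: "D' *v z \<noteq> 0" and nz: "\<And>m. det (\<Omega> (E z (A m))) \<noteq> 0" for z
  proof -
    have lim: "(\<lambda>m. D (s m) *v z) \<longlonglongrightarrow> D' *v z"
      unfolding matrix_vector_mult_def using s(2)
      by (intro tendsto_intros tendsto_vec_lambda) (simp add: o_def)
    have "D m *v z \<in> ?V" for m
      using orth_proj_works[OF V, of "A m *v z"] V
      by (simp add: D_def subspace_scale scaleR_matrix_vector_assoc[symmetric]
          flip: matrix_vector_mul_assoc)
    then have inV: "D' *v z \<in> ?V"
      using closed_sequentially[OF closed_subspace[OF V] _ lim] by blast
    have "D' *v z \<in> span (columns X)"
      using range_subset_span_gram_columns[of D' z] s(3) S(2) by blast
    then obtain \<gamma> where \<gamma>: "D' *v z = X *v \<gamma>"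
      by (auto simp: span_columns_eq_range)
    \<comment> \<open>Otherwise the nonzero limit would lie in \<open>?L\<close> and in its
      orthogonal complement.\<close>
    have "R *v \<gamma> \<noteq> 0"
    proof
      assume "R *v \<gamma> = 0"
      then have "D' *v z \<in> ?L" using \<gamma> by (auto simp: M0_lin_def)
      then show False using inV z orthogonal_Int_0[OF L] by blast
    qed
    \<comment> \<open>Chosen so that the noise in \<open>\<delta> m *\<^sub>R E z (A m)\<close> is
      \<open>c m *\<^sub>R (A m *v z)\<close>.\<close>
    define \<delta> where "\<delta> m = c m / sqrt \<sigma>2" for m
    have \<delta>: "\<delta> m \<noteq> 0" for m using c[of m] \<open>0 < \<sigma>2\<close> by (simp add: \<delta>_def)
    have "\<exists>\<eta>. \<forall>m. A m *v z - ?P *v (A m *v z) = X *v \<eta> m \<and> R *v \<eta> m = 0"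
    proof (intro choice allI)
      fix m
      have "A m *v z - ?P *v (A m *v z) \<in> ?L"
        using orth_proj_works[OF V, of "A m *v z"] orthogonal_comp_self[OF L] by simp
      then show "\<exists>\<eta>. A m *v z - ?P *v (A m *v z) = X *v \<eta> \<and> R *v \<eta> = 0"
        by (auto simp: M0_lin_def)
    qed
    then obtain \<eta> where \<eta>: "\<And>m. ?P *v (A m *v z) = A m *v z - X *v \<eta> m" "\<And>m. R *v \<eta> m = 0"
      by (metis add_diff_cancel_left' diff_add_cancel)
    \<comment> \<open>The first term restores the mean \<open>\<mu>0\<close> after scaling; the
      second removes the component of the noise in \<open>?L\<close>, leaving
      \<open>D m *v z\<close>.\<close>
    define \<eta>' where "\<eta>' m = (1 - \<delta> m) *\<^sub>R \<beta>0 - c m *\<^sub>R \<eta> m" for m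
    have R\<eta>': "R *v \<eta>' m = (1 - \<delta> m) *\<^sub>R r" for m
      by (simp add: \<eta>'_def matrix_vector_mult_diff_distrib matrix_vector_mult_scaleR \<beta>0 \<eta>(2))
    have eq: "\<delta> m *\<^sub>R E z (A m) + X *v \<eta>' m = \<mu>0 + D m *v z" for m
    proof -
      have "D m *v z = c m *\<^sub>R (A m *v z) - c m *\<^sub>R (X *v \<eta> m)"
        by (simp add: D_def scaleR_matrix_vector_assoc[symmetric] \<eta>(1) scaleR_diff_right
            flip: matrix_vector_mul_assoc)
      moreover have "\<delta> m *\<^sub>R E z (A m) = \<delta> m *\<^sub>R \<mu>0 + c m *\<^sub>R (A m *v z)"
        using \<open>0 < \<sigma>2\<close>
        by (simp add: E_def \<delta>_def scaleR_add_right scaleR_matrix_vector_assoc[symmetric])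
      ultimately show ?thesis
        by (simp add: \<eta>'_def matrix_vector_mult_diff_distrib matrix_vector_mult_scaleR \<beta>0(1)
            scaleR_diff_left)
    qed
    have "(\<lambda>m. \<delta> (s m) *\<^sub>R E z (A (s m)) + X *v \<eta>' (s m)) \<longlonglongrightarrow> X *v (\<beta>0 + \<gamma>)"
      unfolding eq using tendsto_add[OF tendsto_const[of \<mu>0] lim]
      by (simp add: \<beta>0(1) \<gamma> matrix_vector_right_distrib)
    moreover have "R *v (\<beta>0 + \<gamma>) \<noteq> r"
      using \<open>R *v \<gamma> \<noteq> 0\<close> by (simp add: matrix_vector_right_distrib \<beta>0)
    ultimately show ?thesis
      unfolding T using nz \<delta> R\<eta>' by (intro eventually_F_type_stat_ge[OF est nonneg])
  qed

  \<comment> \<open>Passage to the limit and the supremum\<close>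
  define p where "p \<Sigma> = measure (gaussian_measure \<mu>0 (\<sigma>2 *\<^sub>R \<Sigma>)) {y. C \<le> T y}" for \<Sigma>
  have p_eq: "p \<Sigma> = measure ?\<gamma> {z. C \<le> T (E z A)}"
    if "\<Sigma> = A ** transpose A" "invertible A" for \<Sigma> A
    unfolding p_def gauss[OF that] by (subst measure_distr) (auto simp: vimage_def)
  have p_le: "p \<Sigma> \<le> 1" if "\<Sigma> \<in> \<CC>" for \<Sigma>
    using factor[OF that] p_eq \<gamma>.prob_le_1 by metis
  have "(\<lambda>m. \<integral>z. indicator {z. C \<le> T (E z (A (s m)))} z \<partial>?\<gamma>) \<longlonglongrightarrow> (\<integral>z. (1::real) \<partial>?\<gamma>)"
  proof (rule integral_dominated_convergence[where w = "\<lambda>_. 1"])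
    \<comment> \<open>The countably many exceptional null sets are combined into one.\<close>
    have "AE z in ?\<gamma>. \<forall>m. det (\<Omega> (E z (A m))) \<noteq> 0"
      using ae_det by (simp add: AE_all_countable)
    with ae_D show "AE z in ?\<gamma>. (\<lambda>m. indicator {z. C \<le> T (E z (A (s m)))} z) \<longlonglongrightarrow> (1::real)"
    proof eventually_elim
      case (elim z)
      then have "\<forall>\<^sub>F m in sequentially. C \<le> T (E z (A (s m)))" using ev by blast
      then show ?case
        by (intro tendsto_eventually) (auto elim: eventually_mono)
    qed
  qed (auto simp: indicator_def)
  moreover have "measure ?\<gamma> UNIV = 1"
    using \<gamma>.prob_space by simp
  ultimately have lim: "(\<lambda>m. p (\<Sigma> (s m))) \<longlonglongrightarrow> 1"
    by (simp add: p_eq[OF A])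
  \<comment> \<open>The supremum of reals is meaningful only for a nonempty set bounded
    above.\<close>
  have "bdd_above (p ` \<CC>)" using p_le by (auto intro!: bdd_aboveI)
  then have "p (\<Sigma> (s m)) \<le> (SUP \<Sigma>\<in>\<CC>. p \<Sigma>)" for m
    using \<Sigma>(1) by (intro cSUP_upper)
  then have "1 \<le> (SUP \<Sigma>\<in>\<CC>. p \<Sigma>)"
    using LIMSEQ_le_const2[OF lim] by blast
  moreover have "(SUP \<Sigma>\<in>\<CC>. p \<Sigma>) \<le> 1"
    using assms(4) p_le by (intro cSUP_least) (auto simp: covariance_model_def)
  ultimately show ?thesis by (simp add: p_def)
qed

end
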